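(* Let $X_1,X_2,\ldots$ be a sequence of i.i.d. positive random variables with $\mathbb{E}[X_1]=1$ and $\mathbb{E}[|X_1|^3]<\infty$. Then, for each $a\ge0$, $$\frac{T_{n,a}}{n}\longrightarrow \Delta_a:=\int_0^\infty z^2(y)\exp(-ay)\,dy\quad\text{in probability as } n\to\infty,$$ where $z(y)=\mathbb{E}\left[(X_1-y-1)\mathbf{1}\{X_1>y\}\right]$, $y>0$.
   Context: For positive random variables $X_1,\ldots,X_n$ put $\overline{X}_n=\frac1n\sum_{j=1}^nX_j$ and $Y_j=X_j/\overline{X}_n$, $j=1,\ldots,n$ (scaled data; depending on $n$). The test statistic is $$T_{n,a}=n\int_0^\infty\left|\frac1n\sum_{j=1}^n(Y_j-y-1)\mathbf{1}\{Y_j>y\}\right|^2\exp(-ay)\,dy,\quad a\ge0.$$ *)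

theory Defs
  imports "HOL-Probability.Probability"
begin

(* Z n converges to L in probability.  Measurability is part of the notion: measure M A is 0
   for a nonmeasurable A, so the limit alone would not exclude nonmeasurable Z n. *)
definition converges_in_prob ::
  "'a measure \<Rightarrow> (nat \<Rightarrow> 'a \<Rightarrow> real) \<Rightarrow> ('a \<Rightarrow> real) \<Rightarrow> bool" where
  "converges_in_prob M Z L \<longleftrightarrow>
     (\<forall>n. Z n \<in> borel_measurable M) \<and> L \<in> borel_measurable M \<and>
     (\<forall>\<epsilon>>0. (\<lambda>n. measure M {\<omega> \<in> space M. \<bar>Z n \<omega> - L \<omega>\<bar> > \<epsilon>}) \<longlonglongrightarrow> 0)"

(* Sequences are indexed from 1; the value X 0 is never used. *)
definition sample_mean :: "(nat \<Rightarrow> 'a \<Rightarrow> real) \<Rightarrow> nat \<Rightarrow> 'a \<Rightarrow> real" where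
  "sample_mean X n \<omega> = 1 / real n * (\<Sum>j=1..n. X j \<omega>)"

definition scaled :: "(nat \<Rightarrow> 'a \<Rightarrow> real) \<Rightarrow> nat \<Rightarrow> nat \<Rightarrow> 'a \<Rightarrow> real" where
  "scaled X n j \<omega> = X j \<omega> / sample_mean X n \<omega>"

definition T_stat :: "(nat \<Rightarrow> 'a \<Rightarrow> real) \<Rightarrow> nat \<Rightarrow> real \<Rightarrow> 'a \<Rightarrow> real" where
  "T_stat X n a \<omega> = real n *
     (LINT y:{0<..}|lborel.
        \<bar>1 / real n * (\<Sum>j=1..n. (scaled X n j \<omega> - y - 1) * indicator {y<..} (scaled X n j \<omega>))\<bar>\<^sup>2
          * exp (- a * y))"

definition z_fun :: "'a measure \<Rightarrow> ('a \<Rightarrow> real) \<Rightarrow> real \<Rightarrow> real" where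
  "z_fun M V y = (LINT \<omega>|M. (V \<omega> - y - 1) * indicator {y<..} (V \<omega>))"

definition Delta :: "'a measure \<Rightarrow> ('a \<Rightarrow> real) \<Rightarrow> real \<Rightarrow> real" where
  "Delta M V a = (LINT y:{0<..}|lborel. (z_fun M V y)\<^sup>2 * exp (- a * y))"

end

theory Submission
  imports Defs
begin

text \<open>
  Let \<open>s\<close> be the sample mean. Substituting \<open>u = s y\<close> gives
  \<open>T / n = (1 / s) \<integral> (A\<^sub>n(u) / s - B\<^sub>n(u))\<^sup>2 exp (- a u / s) du\<close> with the unscaled empirical functions
  \<open>A\<^sub>n(u) = (1 / n) \<Sum> max 0 (X\<^sub>j - u)\<close> and \<open>B\<^sub>n(u) = (1 / n) \<Sum> 1{X\<^sub>j > u}\<close>.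
  With \<open>A\<close>, \<open>B\<close> their means, the variance of an average and Fubini bound the expectations of
  \<open>\<integral> (A\<^sub>n - A)\<^sup>2\<close>, \<open>\<integral> (B\<^sub>n - B)\<^sup>2\<close> and \<open>(s - 1)\<^sup>2\<close> by a multiple of
  \<open>E(|X| + |X|\<^sup>3) / n\<close>. The functional \<open>(s, A, B) \<mapsto> (1 / s) \<integral> (A / s - B)\<^sup>2 exp (- a u / s) du\<close>
  is continuous at \<open>s = 1\<close> in these distances, so Markov's inequality finishes the proof.
\<close>

section \<open>Second-moment bounds for averages of i.i.d. variables\<close>

text \<open>After centring, independence kills the off-diagonal terms of the squared sum. The
  remaining \<open>n\<close> diagonal terms are variances, each at most \<open>q\<close>, and the
  prefactor is \<open>1 / n^2\<close>.\<close>

lemma (in prob_space) iid_mean_deviation: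
  fixes V :: "nat \<Rightarrow> 'a \<Rightarrow> real"
  assumes indep: "indep_vars (\<lambda>_. borel) V {1..}"
    and sq: "\<And>i. i \<ge> 1 \<Longrightarrow> integrable M (\<lambda>\<omega>. (V i \<omega>)\<^sup>2)"
    and mean: "\<And>i. i \<ge> 1 \<Longrightarrow> expectation (V i) = m"
    and second: "\<And>i. i \<ge> 1 \<Longrightarrow> expectation (\<lambda>\<omega>. (V i \<omega>)\<^sup>2) = q"
    and n: "n \<ge> 1"
  shows "integrable M (\<lambda>\<omega>. (1 / real n * (\<Sum>j=1..n. V j \<omega>) - m)\<^sup>2)"
    and "expectation (\<lambda>\<omega>. (1 / real n * (\<Sum>j=1..n. V j \<omega>) - m)\<^sup>2) \<le> q / real n"
proof -
  define U where "U i \<omega> = V i \<omega> - m" for i \<omega>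
  have rv[measurable]: "V i \<in> borel_measurable M" if "i \<ge> 1" for i
    using indep that by (auto simp: indep_vars_def)
  have V1: "integrable M (V i)" if "i \<ge> 1" for i
    using square_integrable_imp_integrable[OF rv sq] that by blast
  have U1: "integrable M (U i)" and EU: "expectation (U i) = 0" if "i \<ge> 1" for i
    unfolding U_def using V1[OF that] mean[OF that] by (auto simp: prob_space)
  have U2: "integrable M (\<lambda>\<omega>. (U i \<omega>)\<^sup>2)" if "i \<ge> 1" for i
    unfolding U_def power2_diff using V1[OF that] sq[OF that] by auto
  have EU2: "expectation (\<lambda>\<omega>. (U i \<omega>)\<^sup>2) \<le> q" if "i \<ge> 1" for i
    using variance_eq[OF V1[OF that] sq[OF that]] unfolding mean[OF that] second[OF that] U_def by simp
  have indU: "indep_vars (\<lambda>_. borel) U {1..}"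
    unfolding U_def using indep by (rule indep_vars_compose2) auto
  have cross: "integrable M (\<lambda>\<omega>. U i \<omega> * U j \<omega>) \<and> expectation (\<lambda>\<omega>. U i \<omega> * U j \<omega>) = 0"
    if ij: "i \<ge> 1" "j \<ge> 1" "i \<noteq> j" for i j
  proof -
    have "indep_vars (\<lambda>_. borel) U {i, j}"
      by (rule indep_vars_subset[OF indU]) (use ij in auto)
    \<comment> \<open>Product rules for independent families range over finite index sets; since
      \<open>i \<noteq> j\<close>, the product over \<open>{i, j}\<close> is
      \<open>U i * U j\<close>.\<close>
    then have "integrable M (\<lambda>\<omega>. \<Prod>k\<in>{i,j}. U k \<omega>)"
      and "expectation (\<lambda>\<omega>. \<Prod>k\<in>{i,j}. U k \<omega>) = (\<Prod>k\<in>{i,j}. expectation (U k))"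
      using U1 ij by (intro indep_vars_integrable indep_vars_lebesgue_integral; force)+
    then show ?thesis
      using ij EU by simp
  qed
  have prod_int: "integrable M (\<lambda>\<omega>. U i \<omega> * U j \<omega>)" if "i \<ge> 1" "j \<ge> 1" for i j
    using cross[OF that] U2[OF that(1)] by (cases "i = j") (auto simp: power2_eq_square)
  have eq: "(1 / real n * (\<Sum>j=1..n. V j \<omega>) - m)\<^sup>2
      = (1 / real n)\<^sup>2 * (\<Sum>i=1..n. \<Sum>j=1..n. U i \<omega> * U j \<omega>)" for \<omega>
  proof -
    have "1 / real n * (\<Sum>j=1..n. V j \<omega>) - m = 1 / real n * (\<Sum>j=1..n. U j \<omega>)"
      using n by (simp add: U_def sum_subtractf field_simps)
    then show ?thesis
      by (simp add: power_mult_distrib power2_eq_square sum_product)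
  qed
  show "integrable M (\<lambda>\<omega>. (1 / real n * (\<Sum>j=1..n. V j \<omega>) - m)\<^sup>2)"
    unfolding eq using prod_int
    by (intro integrable_mult_right Bochner_Integration.integrable_sum) auto
  \<comment> \<open>Each row of the double sum reduces to its diagonal entry, which is at most
    \<open>q\<close> because centring subtracts \<open>m^2\<close> from the second moment.\<close>
  have "(\<Sum>i=1..n. \<Sum>j=1..n. expectation (\<lambda>\<omega>. U i \<omega> * U j \<omega>)) \<le> (\<Sum>i=1..n. q)"
  proof (rule sum_mono)
    fix i assume i: "i \<in> {1..n}"
    have "(\<Sum>j=1..n. expectation (\<lambda>\<omega>. U i \<omega> * U j \<omega>))
        = (\<Sum>j\<in>{i}. expectation (\<lambda>\<omega>. U i \<omega> * U j \<omega>))"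
      using i cross by (intro sum.mono_neutral_right) auto
    then show "(\<Sum>j=1..n. expectation (\<lambda>\<omega>. U i \<omega> * U j \<omega>)) \<le> q"
      using EU2[of i] i by (simp add: power2_eq_square)
  qed
  also have "(\<Sum>i=1..n. q) = real n * q" by simp
  finally have "(1 / real n)\<^sup>2 * (\<Sum>i=1..n. \<Sum>j=1..n. expectation (\<lambda>\<omega>. U i \<omega> * U j \<omega>))
      \<le> (1 / real n)\<^sup>2 * (real n * q)"
    by (rule mult_left_mono) simp
  also have "\<dots> = q / real n" using n by (simp add: power2_eq_square)
  also have "(1 / real n)\<^sup>2 * (\<Sum>i=1..n. \<Sum>j=1..n. expectation (\<lambda>\<omega>. U i \<omega> * U j \<omega>))
      = expectation (\<lambda>\<omega>. (1 / real n * (\<Sum>j=1..n. V j \<omega>) - m)\<^sup>2)"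
    unfolding eq using prod_int
    by (subst integral_mult_right_zero, subst Bochner_Integration.integral_sum)
       (auto intro!: sum.cong simp: Bochner_Integration.integral_sum)
  finally show "expectation (\<lambda>\<omega>. (1 / real n * (\<Sum>j=1..n. V j \<omega>) - m)\<^sup>2) \<le> q / real n" .
qed

text \<open>The extended nonnegative form also covers an infinite second moment, where the right
  side is infinite as \<open>n \<ge> 1\<close>. The bound can therefore be applied at every
  parameter value under an outer integral.\<close>

lemma (in prob_space) nn_integral_mean_deviation_le:
  fixes X :: "nat \<Rightarrow> 'a \<Rightarrow> real" and f :: "real \<Rightarrow> real"
  assumes indep: "indep_vars (\<lambda>_. borel) X {1..}"
    and ident: "\<And>i. i \<ge> 1 \<Longrightarrow> distr M borel (X i) = distr M borel (X 1)"
    and [measurable]: "f \<in> borel_measurable borel" and n: "n \<ge> 1"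
  shows "(\<integral>\<^sup>+\<omega>. ennreal ((1 / real n * (\<Sum>j=1..n. f (X j \<omega>)) - expectation (\<lambda>\<omega>. f (X 1 \<omega>)))\<^sup>2) \<partial>M)
    \<le> ennreal (1 / real n) * (\<integral>\<^sup>+\<omega>. ennreal ((f (X 1 \<omega>))\<^sup>2) \<partial>M)"
proof (cases "(\<integral>\<^sup>+\<omega>. ennreal ((f (X 1 \<omega>))\<^sup>2) \<partial>M) = \<infinity>")
  case True
  then show ?thesis using n by (simp add: ennreal_mult_top)
next
  case False
  have rv[measurable]: "X i \<in> borel_measurable M" if "i \<ge> 1" for i
    using indep that by (auto simp: indep_vars_def)
  have sq1: "integrable M (\<lambda>\<omega>. (f (X 1 \<omega>))\<^sup>2)"
    using False by (intro integrableI_nonneg) (auto simp: top.not_eq_extremum)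
  \<comment> \<open>Both sides are integrals of \<open>g\<close> against the common law of
    \<open>X i\<close> and \<open>X 1\<close> on the reals.\<close>
  have transfer: "integrable M (\<lambda>\<omega>. g (X i \<omega>)) \<longleftrightarrow> integrable M (\<lambda>\<omega>. g (X 1 \<omega>))"
    "expectation (\<lambda>\<omega>. g (X i \<omega>)) = expectation (\<lambda>\<omega>. g (X 1 \<omega>))"
    if i: "i \<ge> 1" and [measurable]: "g \<in> borel_measurable borel" for i and g :: "real \<Rightarrow> real"
    using integrable_distr_eq[OF rv[OF i], of g] integrable_distr_eq[OF rv[of 1], of g]
      integral_distr[OF rv[OF i], of g] integral_distr[OF rv[of 1], of g] ident[OF i] by auto
  have ind: "indep_vars (\<lambda>_. borel) (\<lambda>i \<omega>. f (X i \<omega>)) {1..}"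
    using indep by (rule indep_vars_compose2) auto
  have sq: "integrable M (\<lambda>\<omega>. (f (X i \<omega>))\<^sup>2)" if "i \<ge> 1" for i
    using transfer(1)[OF that, of "\<lambda>x. (f x)\<^sup>2"] sq1 by simp
  have m: "expectation (\<lambda>\<omega>. f (X i \<omega>)) = expectation (\<lambda>\<omega>. f (X 1 \<omega>))" if "i \<ge> 1" for i
    using transfer(2)[OF that, of f] by simp
  have q: "expectation (\<lambda>\<omega>. (f (X i \<omega>))\<^sup>2) = expectation (\<lambda>\<omega>. (f (X 1 \<omega>))\<^sup>2)" if "i \<ge> 1" for i
    using transfer(2)[OF that, of "\<lambda>x. (f x)\<^sup>2"] by simp
  note dev = iid_mean_deviation[OF ind sq m q n]
  have "(\<integral>\<^sup>+\<omega>. ennreal ((1 / real n * (\<Sum>j=1..n. f (X j \<omega>)) - expectation (\<lambda>\<omega>. f (X 1 \<omega>)))\<^sup>2) \<partial>M)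
      = ennreal (expectation (\<lambda>\<omega>. (1 / real n * (\<Sum>j=1..n. f (X j \<omega>)) - expectation (\<lambda>\<omega>. f (X 1 \<omega>)))\<^sup>2))"
    by (rule nn_integral_eq_integral[OF dev(1)]) auto
  also have "\<dots> \<le> ennreal (expectation (\<lambda>\<omega>. (f (X 1 \<omega>))\<^sup>2) / real n)"
    by (rule ennreal_leI[OF dev(2)])
  also have "\<dots> = ennreal (1 / real n) * ennreal (expectation (\<lambda>\<omega>. (f (X 1 \<omega>))\<^sup>2))"
    by (simp flip: ennreal_mult')
  also have "ennreal (expectation (\<lambda>\<omega>. (f (X 1 \<omega>))\<^sup>2)) = (\<integral>\<^sup>+\<omega>. ennreal ((f (X 1 \<omega>))\<^sup>2) \<partial>M)"
    by (rule nn_integral_eq_integral[OF sq1, symmetric]) auto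
  finally show ?thesis .
qed

text \<open>Nonnegativity of the variance, in a form that stays true when the second moment is
  infinite.\<close>

lemma (in prob_space) ennreal_expectation_square_le:
  fixes f :: "'a \<Rightarrow> real"
  assumes [measurable]: "f \<in> borel_measurable M"
  shows "ennreal ((expectation f)\<^sup>2) \<le> (\<integral>\<^sup>+\<omega>. ennreal ((f \<omega>)\<^sup>2) \<partial>M)"
proof (cases "(\<integral>\<^sup>+\<omega>. ennreal ((f \<omega>)\<^sup>2) \<partial>M) = \<infinity>")
  case False
  then have sq: "integrable M (\<lambda>\<omega>. (f \<omega>)\<^sup>2)"
    by (intro integrableI_nonneg) (auto simp: top.not_eq_extremum)
  have "0 \<le> expectation (\<lambda>\<omega>. (f \<omega>)\<^sup>2) - (expectation f)\<^sup>2"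
    using variance_positive[of f]
    unfolding variance_eq[OF square_integrable_imp_integrable[OF assms sq] sq] .
  then show ?thesis
    using sq by (subst nn_integral_eq_integral) (auto intro: ennreal_leI)
qed simp

text \<open>Tonelli moves the integral over \<open>u\<close> outside, the bound for a single
  function applies at each fixed \<open>u\<close>, and Tonelli moves it back. The outcome is a law
  of large numbers in \<open>L2(N)\<close> with rate \<open>1 / n\<close>.\<close>

lemma (in prob_space) nn_integral_kernel_mean_deviation_le:
  fixes X :: "nat \<Rightarrow> 'a \<Rightarrow> real" and h :: "real \<Rightarrow> 'b \<Rightarrow> real"
  assumes indep: "indep_vars (\<lambda>_. borel) X {1..}"
    and ident: "\<And>i. i \<ge> 1 \<Longrightarrow> distr M borel (X i) = distr M borel (X 1)"
    and "sigma_finite_measure N"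
    and h[measurable]: "case_prod h \<in> borel_measurable (borel \<Otimes>\<^sub>M N)" and n: "n \<ge> 1"
  shows "(\<integral>\<^sup>+\<omega>. \<integral>\<^sup>+u. ennreal ((1 / real n * (\<Sum>j=1..n. h (X j \<omega>) u)
        - expectation (\<lambda>\<omega>. h (X 1 \<omega>) u))\<^sup>2) \<partial>N \<partial>M)
    \<le> ennreal (1 / real n) * (\<integral>\<^sup>+\<omega>. \<integral>\<^sup>+u. ennreal ((h (X 1 \<omega>) u)\<^sup>2) \<partial>N \<partial>M)"
proof -
  interpret N: sigma_finite_measure N by fact
  interpret P: pair_sigma_finite M N ..
  have rv[measurable]: "X i \<in> borel_measurable M" if "i \<ge> 1" for i
    using indep that by (auto simp: indep_vars_def)
  have rv1[measurable]: "X (Suc 0) \<in> borel_measurable M" using rv[of 1] by simp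
  have hm[measurable]: "(\<lambda>x. h x u) \<in> borel_measurable borel" if "u \<in> space N" for u
    using measurable_Pair1[of "case_prod h" borel N] that by measurable
  have hX[measurable]: "(\<lambda>p. h (X j (fst p)) (snd p)) \<in> borel_measurable (M \<Otimes>\<^sub>M N)" if "j \<ge> 1" for j
  proof -
    have [measurable]: "X j \<in> borel_measurable M" by (rule rv[OF that])
    show ?thesis by measurable
  qed
  have [measurable]: "(\<lambda>p. \<Sum>j=1..n. h (X j (fst p)) (snd p)) \<in> borel_measurable (M \<Otimes>\<^sub>M N)"
    by (intro borel_measurable_sum hX) auto
  have "(\<integral>\<^sup>+\<omega>. \<integral>\<^sup>+u. ennreal ((1 / real n * (\<Sum>j=1..n. h (X j \<omega>) u)
        - expectation (\<lambda>\<omega>. h (X 1 \<omega>) u))\<^sup>2) \<partial>N \<partial>M)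
      = (\<integral>\<^sup>+u. \<integral>\<^sup>+\<omega>. ennreal ((1 / real n * (\<Sum>j=1..n. h (X j \<omega>) u)
        - expectation (\<lambda>\<omega>. h (X 1 \<omega>) u))\<^sup>2) \<partial>M \<partial>N)"
    by (intro P.Fubini'[symmetric]) (simp add: split_beta')
  also have "\<dots> \<le> (\<integral>\<^sup>+u. ennreal (1 / real n) * (\<integral>\<^sup>+\<omega>. ennreal ((h (X 1 \<omega>) u)\<^sup>2) \<partial>M) \<partial>N)"
    by (intro nn_integral_mono nn_integral_mean_deviation_le indep ident n hm)
  also have "\<dots> = ennreal (1 / real n) * (\<integral>\<^sup>+u. \<integral>\<^sup>+\<omega>. ennreal ((h (X 1 \<omega>) u)\<^sup>2) \<partial>M \<partial>N)"
    by (intro nn_integral_cmult) simp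
  also have "(\<integral>\<^sup>+u. \<integral>\<^sup>+\<omega>. ennreal ((h (X 1 \<omega>) u)\<^sup>2) \<partial>M \<partial>N)
      = (\<integral>\<^sup>+\<omega>. \<integral>\<^sup>+u. ennreal ((h (X 1 \<omega>) u)\<^sup>2) \<partial>N \<partial>M)"
    by (intro P.Fubini') simp
  finally show ?thesis .
qed

text \<open>The squared mean is at most the mean square at each \<open>u\<close>, and Tonelli
  integrates this over \<open>u\<close>. It places the limiting profiles \<open>A\<close> and
  \<open>B\<close> of the main proof in \<open>L2\<close>.\<close>

lemma (in prob_space) integrable_kernel_mean_square:
  fixes V :: "'a \<Rightarrow> real" and h :: "real \<Rightarrow> 'b \<Rightarrow> real"
  assumes [measurable]: "V \<in> borel_measurable M"
    and "sigma_finite_measure N"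
    and h[measurable]: "case_prod h \<in> borel_measurable (borel \<Otimes>\<^sub>M N)"
    and fin: "(\<integral>\<^sup>+\<omega>. \<integral>\<^sup>+u. ennreal ((h (V \<omega>) u)\<^sup>2) \<partial>N \<partial>M) < \<infinity>"
  shows "integrable N (\<lambda>u. (expectation (\<lambda>\<omega>. h (V \<omega>) u))\<^sup>2)"
proof (rule integrableI_nonneg)
  interpret N: sigma_finite_measure N by fact
  interpret P: pair_sigma_finite M N ..
  have hm[measurable]: "(\<lambda>x. h x u) \<in> borel_measurable borel" if "u \<in> space N" for u
    using measurable_Pair1[of "case_prod h" borel N] that by measurable
  show "(\<lambda>u. (expectation (\<lambda>\<omega>. h (V \<omega>) u))\<^sup>2) \<in> borel_measurable N" by measurable
  have "(\<integral>\<^sup>+u. ennreal ((expectation (\<lambda>\<omega>. h (V \<omega>) u))\<^sup>2) \<partial>N)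
      \<le> (\<integral>\<^sup>+u. \<integral>\<^sup>+\<omega>. ennreal ((h (V \<omega>) u)\<^sup>2) \<partial>M \<partial>N)"
    by (intro nn_integral_mono ennreal_expectation_square_le) measurable
  also have "\<dots> = (\<integral>\<^sup>+\<omega>. \<integral>\<^sup>+u. ennreal ((h (V \<omega>) u)\<^sup>2) \<partial>N \<partial>M)"
    by (intro P.Fubini') simp
  finally show "(\<integral>\<^sup>+u. ennreal ((expectation (\<lambda>\<omega>. h (V \<omega>) u))\<^sup>2) \<partial>N) < \<infinity>"
    using fin by simp
qed simp

section \<open>Stability of the weighted quadratic functional\<close>

text \<open>The error splits in two: first \<open>A'\<close>, \<open>B'\<close> are replaced by
  \<open>A\<close>, \<open>B\<close> at fixed \<open>s\<close>, then \<open>s\<close> is replaced by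
  1. The first part is bounded by the two \<open>L2\<close> distances, the second by dominated
  convergence. The statement is deterministic and \<open>c\<close> is uniform in \<open>A'\<close>,
  \<open>B'\<close> and \<open>s\<close>, so it can be used outcome by outcome.\<close>

lemma scaled_energy_stable:
  fixes N :: "real measure" and A B :: "real \<Rightarrow> real"
  assumes [measurable]: "A \<in> borel_measurable N" "B \<in> borel_measurable N"
      "(\<lambda>u. u) \<in> borel_measurable N"
    and pos: "\<And>u. u \<in> space N \<Longrightarrow> 0 \<le> u" and a: "0 \<le> a" and e: "0 < e"
    and A2: "integrable N (\<lambda>u. (A u)\<^sup>2)" and B2: "integrable N (\<lambda>u. (B u)\<^sup>2)"
  obtains c where "0 < c"
    "\<And>A' B' s. A' \<in> borel_measurable N \<Longrightarrow> B' \<in> borel_measurable N \<Longrightarrow> (s - 1)\<^sup>2 < c \<Longrightarrow>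
      (\<integral>\<^sup>+u. ennreal ((A' u - A u)\<^sup>2) \<partial>N) < ennreal c \<Longrightarrow>
      (\<integral>\<^sup>+u. ennreal ((B' u - B u)\<^sup>2) \<partial>N) < ennreal c \<Longrightarrow>
      0 < s \<and> \<bar>1 / s * (LINT u|N. (1 / s * A' u - B' u)\<^sup>2 * exp (- a * u / s))
        - (LINT u|N. (A u - B u)\<^sup>2 * exp (- a * u))\<bar> < e"
proof -
  define F where "F s = 1 / s * (LINT u|N. (1 / s * A u - B u)\<^sup>2 * exp (- a * u / s))" for s
  have sq_le: "(x - y)\<^sup>2 \<le> 2 * x\<^sup>2 + 2 * y\<^sup>2" for x y :: real
    using zero_le_power2[of "x + y"] by (simp add: power2_eq_square algebra_simps)
  \<comment> \<open>On this interval \<open>1 / s \<le> 2\<close>, so \<open>sq_le\<close> produces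
    the constants \<open>2 * 4 = 8\<close> and \<open>2\<close>.\<close>
  have scale_le: "(1 / s * x - y)\<^sup>2 \<le> 8 * x\<^sup>2 + 2 * y\<^sup>2" if "s \<in> {1/2..2}" for s x y :: real
  proof -
    have "(1 / s * x)\<^sup>2 \<le> 4 * x\<^sup>2"
      using that power_mono[of "1 / s" 2 2] unfolding power_mult_distrib
      by (intro mult_right_mono) (auto simp: field_simps)
    then show ?thesis using sq_le[of "1 / s * x" y] by simp
  qed
  have exp_le: "exp (- a * u / s) \<le> 1" if "s \<in> {1/2..2}" "u \<in> space N" for s u
    using that pos[of u] a by (auto intro!: divide_nonpos_pos)
  have dom: "integrable N (\<lambda>u. 8 * (A u)\<^sup>2 + 2 * (B u)\<^sup>2)"
    using A2 B2 by auto
  have gint: "integrable N (\<lambda>u. (1 / s * A u - B u)\<^sup>2)" if "s \<in> {1/2..2}" for s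
    using scale_le[OF that] by (intro Bochner_Integration.integrable_bound[OF dom]) auto
  \<comment> \<open>Sequential continuity fits dominated convergence: \<open>8 A^2 + 2 B^2\<close>
    dominates for all \<open>s\<close> in the interval at once.\<close>
  have "continuous_on {1/2..2} F"
  proof (rule continuous_on_sequentiallyI)
    fix v :: "nat \<Rightarrow> real" and s :: real
    assume v: "\<forall>n. v n \<in> {1/2..2}" and s: "s \<in> {1/2..2}" and lim: "v \<longlonglongrightarrow> s"
    have "(\<lambda>n. LINT u|N. (1 / v n * A u - B u)\<^sup>2 * exp (- a * u / v n))
      \<longlonglongrightarrow> (LINT u|N. (1 / s * A u - B u)\<^sup>2 * exp (- a * u / s))"
    proof (rule integral_dominated_convergence[OF _ _ dom])
      show "AE u in N. (\<lambda>n. (1 / v n * A u - B u)\<^sup>2 * exp (- a * u / v n))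
          \<longlonglongrightarrow> (1 / s * A u - B u)\<^sup>2 * exp (- a * u / s)"
        using s by (intro AE_I2 tendsto_intros lim) auto
      fix n
      show "AE u in N. norm ((1 / v n * A u - B u)\<^sup>2 * exp (- a * u / v n)) \<le> 8 * (A u)\<^sup>2 + 2 * (B u)\<^sup>2"
      proof (rule AE_I2)
        fix u assume u: "u \<in> space N"
        have "(1 / v n * A u - B u)\<^sup>2 * exp (- a * u / v n) \<le> (8 * (A u)\<^sup>2 + 2 * (B u)\<^sup>2) * 1"
          using v u by (intro mult_mono scale_le exp_le) auto
        then show "norm ((1 / v n * A u - B u)\<^sup>2 * exp (- a * u / v n)) \<le> 8 * (A u)\<^sup>2 + 2 * (B u)\<^sup>2"
          by (simp add: abs_mult)
      qed
    qed measurable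
    then show "(\<lambda>n. F (v n)) \<longlonglongrightarrow> F s"
      unfolding F_def using s by (intro tendsto_intros lim) auto
  qed
  then have "1 \<in> {1/2..2::real} \<longrightarrow> (\<exists>d>0. \<forall>s\<in>{1/2..2}. \<bar>s - 1\<bar> < d \<longrightarrow> \<bar>F s - F 1\<bar> < e / 2)"
    using half_gt_zero[OF e] unfolding continuous_on_iff dist_real_def by blast
  then obtain d where d: "d > 0" "\<And>s. s \<in> {1/2..2} \<Longrightarrow> \<bar>s - 1\<bar> < d \<Longrightarrow> \<bar>F s - F 1\<bar> < e / 2"
    by auto
  \<comment> \<open>The summand 1 makes \<open>K\<close> positive, so that \<open>\<delta>\<close>
    is well defined and \<open>\<delta> * K = e / 8\<close>.\<close>
  define K where "K = (LINT u|N. 8 * (A u)\<^sup>2 + 2 * (B u)\<^sup>2) + 1"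
  have K: "K > 0" unfolding K_def by (intro add_nonneg_pos integral_nonneg_AE) auto
  define \<delta> where "\<delta> = e / (8 * K)"
  have \<delta>: "\<delta> > 0" using e K by (simp add: \<delta>_def)
  define L where "L = 1 + 1 / \<delta>"
  have L: "L > 0" using \<delta> by (simp add: L_def add_pos_pos)
  \<comment> \<open>The bound \<open>1/4\<close> keeps \<open>s\<close> within \<open>1/2\<close> of
    1, and \<open>d^2\<close> gives \<open>\<bar>s - 1\<bar> < d\<close>. The third term gives
    \<open>10 * L * c \<le> e / 8\<close>; with \<open>\<delta> * K\<close> this makes
    \<open>e / 4\<close>, and the outer factor \<open>1 / s \<le> 2\<close> turns it into
    \<open>e / 2\<close>.\<close>
  define c where "c = min (min (1/4) (d\<^sup>2)) (e / (80 * L))"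
  have c: "c > 0" "c \<le> 1/4" "c \<le> d\<^sup>2" "c \<le> e / (80 * L)"
    using d(1) e L by (auto simp: c_def)
  then have Lc: "20 * L * c \<le> e / 4"
    using L by (simp add: field_simps)
  show thesis
  proof (rule that[OF c(1)])
    fix A' B' :: "real \<Rightarrow> real" and s :: real
    assume [measurable]: "A' \<in> borel_measurable N" "B' \<in> borel_measurable N"
      and s_c: "(s - 1)\<^sup>2 < c"
      and DA: "(\<integral>\<^sup>+u. ennreal ((A' u - A u)\<^sup>2) \<partial>N) < ennreal c"
      and DB: "(\<integral>\<^sup>+u. ennreal ((B' u - B u)\<^sup>2) \<partial>N) < ennreal c"
    have iA: "integrable N (\<lambda>u. (A' u - A u)\<^sup>2)" and iB: "integrable N (\<lambda>u. (B' u - B u)\<^sup>2)"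
      using DA DB by (auto intro!: integrableI_nonneg intro: less_trans)
    have LA: "(LINT u|N. (A' u - A u)\<^sup>2) < c" and LB: "(LINT u|N. (B' u - B u)\<^sup>2) < c"
      using DA DB iA iB c(1) by (auto simp: nn_integral_eq_integral ennreal_less_iff)
    have "(s - 1)\<^sup>2 < (1/2)\<^sup>2" "(s - 1)\<^sup>2 < d\<^sup>2"
      using s_c c by (auto simp: power2_eq_square)
    then have "\<bar>s - 1\<bar>\<^sup>2 < (1/2)\<^sup>2" "\<bar>s - 1\<bar>\<^sup>2 < d\<^sup>2"
      by (simp_all only: power2_abs)
    then have s_half: "\<bar>s - 1\<bar> < 1/2" and sd: "\<bar>s - 1\<bar> < d"
      using d(1) power2_less_imp_less[of "\<bar>s - 1\<bar>" "1/2"] power2_less_imp_less[of "\<bar>s - 1\<bar>" d]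
      by linarith+
    from s_half have s: "s \<in> {1/2..2}"
      unfolding atLeastAtMost_iff by linarith
    define f where "f u = 1 / s * A' u - B' u" for u
    define g where "g u = 1 / s * A u - B u" for u
    have [measurable]: "f \<in> borel_measurable N" "g \<in> borel_measurable N"
      unfolding f_def g_def by measurable
    define H where "H u = L * (8 * (A' u - A u)\<^sup>2 + 2 * (B' u - B u)\<^sup>2)
      + \<delta> * (8 * (A u)\<^sup>2 + 2 * (B u)\<^sup>2)" for u
    have Hint: "integrable N H" unfolding H_def using iA iB A2 B2 by auto
    \<comment> \<open>Weighted AM-GM: \<open>2 x y \<le> x\<^sup>2 / \<delta> + \<delta> y\<^sup>2\<close> avoids Cauchy-Schwarz for integrals.\<close>
    have diff: "\<bar>(f u)\<^sup>2 - (g u)\<^sup>2\<bar> \<le> H u" for u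
    proof -
      have "2 * \<bar>x\<bar> * \<bar>y\<bar> \<le> 1 / \<delta> * x\<^sup>2 + \<delta> * y\<^sup>2" for x y :: real
      proof -
        have "0 \<le> (\<bar>x\<bar> - \<delta> * \<bar>y\<bar>)\<^sup>2 / \<delta>" using \<delta> by simp
        also have "\<dots> = 1 / \<delta> * x\<^sup>2 + \<delta> * y\<^sup>2 - 2 * \<bar>x\<bar> * \<bar>y\<bar>"
          using \<delta> by (simp add: power2_diff field_simps power2_eq_square)
        finally show ?thesis by simp
      qed
      from this[of "f u - g u" "g u"]
      have "2 * \<bar>(f u - g u) * g u\<bar> \<le> 1 / \<delta> * (f u - g u)\<^sup>2 + \<delta> * (g u)\<^sup>2"
        by (simp add: abs_mult)
      moreover have "(f u)\<^sup>2 - (g u)\<^sup>2 = (f u - g u)\<^sup>2 + 2 * ((f u - g u) * g u)"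
        by (simp add: power2_eq_square algebra_simps)
      ultimately have "\<bar>(f u)\<^sup>2 - (g u)\<^sup>2\<bar> \<le> L * (f u - g u)\<^sup>2 + \<delta> * (g u)\<^sup>2"
        using zero_le_power2[of "f u - g u"] unfolding L_def distrib_right mult_1_left by linarith
      \<comment> \<open>The difference has the same shape as \<open>g\<close>, so
        \<open>scale_le\<close> bounds both squares.\<close>
      also have "f u - g u = 1 / s * (A' u - A u) - (B' u - B u)"
        by (simp add: f_def g_def algebra_simps)
      also have "L * (1 / s * (A' u - A u) - (B' u - B u))\<^sup>2 + \<delta> * (g u)\<^sup>2 \<le> H u"
        unfolding H_def g_def using L \<delta> by (intro add_mono mult_left_mono scale_le s) auto
      finally show ?thesis .
    qed
    have damp: "\<bar>x * exp (- a * u / s)\<bar> \<le> \<bar>x\<bar>" if "u \<in> space N" for x u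
      using mult_left_mono[OF exp_le[OF s that], of "\<bar>x\<bar>"] by (simp add: abs_mult)
    have dampH: "\<bar>((f u)\<^sup>2 - (g u)\<^sup>2) * exp (- a * u / s)\<bar> \<le> H u" if "u \<in> space N" for u
      by (rule order_trans[OF damp[OF that] diff])
    have gI: "integrable N (\<lambda>u. (g u)\<^sup>2 * exp (- a * u / s))"
      using damp[of _ "(g _)\<^sup>2"]
      by (intro Bochner_Integration.integrable_bound[OF gint[OF s]] AE_I2) (auto simp: g_def)
    have dI: "integrable N (\<lambda>u. ((f u)\<^sup>2 - (g u)\<^sup>2) * exp (- a * u / s))"
      using dampH by (intro Bochner_Integration.integrable_bound[OF Hint] AE_I2)
        (auto intro: order_trans[OF _ abs_ge_self])
    \<comment> \<open>Only the distances of \<open>A'\<close>, \<open>B'\<close> to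
      \<open>A\<close>, \<open>B\<close> are controlled directly, so integrability for
      \<open>f\<close> is recovered by adding the \<open>g\<close> term to the difference.\<close>
    have fI: "integrable N (\<lambda>u. (f u)\<^sup>2 * exp (- a * u / s))"
      using Bochner_Integration.integrable_add[OF dI gI] by (simp add: algebra_simps)
    have "\<bar>LINT u|N. ((f u)\<^sup>2 - (g u)\<^sup>2) * exp (- a * u / s)\<bar> \<le> (LINT u|N. H u)"
      by (intro order_trans[OF integral_abs_bound] integral_mono integrable_abs dI Hint dampH)
    also have "(LINT u|N. H u) = L * (8 * (LINT u|N. (A' u - A u)\<^sup>2) + 2 * (LINT u|N. (B' u - B u)\<^sup>2))
        + \<delta> * (K - 1)"
      unfolding H_def K_def using iA iB A2 B2 by simp
    also have "\<dots> \<le> L * (8 * c + 2 * c) + \<delta> * K"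
      using LA LB L \<delta> by (intro add_mono mult_left_mono) auto
    also have "\<dots> \<le> e / 4"
      using Lc K e by (simp add: \<delta>_def)
    finally have bound: "\<bar>LINT u|N. ((f u)\<^sup>2 - (g u)\<^sup>2) * exp (- a * u / s)\<bar> \<le> e / 4" .
    have "1 / s * (LINT u|N. (f u)\<^sup>2 * exp (- a * u / s)) - F s
        = 1 / s * (LINT u|N. ((f u)\<^sup>2 - (g u)\<^sup>2) * exp (- a * u / s))"
      unfolding F_def g_def[symmetric] using fI gI by (simp add: left_diff_distrib right_diff_distrib)
    also have "\<bar>\<dots>\<bar> \<le> 2 * (e / 4)"
      using s bound unfolding abs_mult by (intro mult_mono) (auto simp: field_simps)
    finally have "\<bar>1 / s * (LINT u|N. (f u)\<^sup>2 * exp (- a * u / s)) - F s\<bar> \<le> e / 2" by simp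
    moreover have "\<bar>F s - F 1\<bar> < e / 2" by (rule d(2)[OF s sd])
    moreover have "F 1 = (LINT u|N. (A u - B u)\<^sup>2 * exp (- a * u))"
      by (simp add: F_def)
    ultimately have "\<bar>1 / s * (LINT u|N. (f u)\<^sup>2 * exp (- a * u / s))
        - (LINT u|N. (A u - B u)\<^sup>2 * exp (- a * u))\<bar> < e"
      by linarith
    then show "0 < s \<and> \<bar>1 / s * (LINT u|N. (1 / s * A' u - B' u)\<^sup>2 * exp (- a * u / s))
        - (LINT u|N. (A u - B u)\<^sup>2 * exp (- a * u))\<bar> < e"
      unfolding f_def using s by simp
  qed
qed

section \<open>Two kernels on the positive half-line\<close>

text \<open>Restricting the space itself, instead of inserting an indicator, makes
  \<open>0 \<le> u\<close> hold at every point, as \<open>scaled_energy_stable\<close>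
  requires.\<close>

abbreviation pos_lborel :: "real measure" where
  "pos_lborel \<equiv> restrict_space lborel {0<..}"

text \<open>The residual \<open>x - u - 1\<close> on \<open>u < x\<close> is the difference of this
  kernel and the next. Averaged over a random \<open>x\<close>, they become the stop-loss transform
  and the survival function.\<close>

definition excess :: "real \<Rightarrow> real \<Rightarrow> real" where
  "excess x u = max 0 (x - u)"

definition exceeds :: "real \<Rightarrow> real \<Rightarrow> real" where
  "exceeds x u = (if u < x then 1 else 0)"

lemma sigma_finite_pos_lborel: "sigma_finite_measure pos_lborel"
  by (rule sigma_finite_measure_restrict_space) (auto intro: lborel.sigma_finite_measure_axioms)

lemma ident_measurable_pos_lborel[measurable]: "(\<lambda>u. u) \<in> borel_measurable pos_lborel"
  by (rule measurable_restrict_space1) simp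

lemma excess_measurable: "case_prod excess \<in> borel_measurable (borel \<Otimes>\<^sub>M pos_lborel)"
  and exceeds_measurable: "case_prod exceeds \<in> borel_measurable (borel \<Otimes>\<^sub>M pos_lborel)"
proof -
  have [measurable]: "snd \<in> borel_measurable (borel \<Otimes>\<^sub>M pos_lborel)"
    using measurable_compose[OF measurable_snd ident_measurable_pos_lborel] by simp
  show "case_prod excess \<in> borel_measurable (borel \<Otimes>\<^sub>M pos_lborel)"
    and "case_prod exceeds \<in> borel_measurable (borel \<Otimes>\<^sub>M pos_lborel)"
    unfolding excess_def exceeds_def split_beta' by measurable
qed

lemma integral_pos_lborel: "(LINT u|pos_lborel. f u) = (LINT u:{0<..}|lborel. (f u :: real))"
  by (simp add: integral_restrict_space set_lebesgue_integral_def)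

text \<open>The integrand has height at most \<open>b\<close> and lives on \<open>(0, x)\<close>.
  Writing \<open>\<bar>x\<bar>\<close> keeps the bound valid for negative \<open>x\<close>, where
  the support is empty.\<close>

lemma nn_integral_pos_lborel_le:
  assumes "\<And>u. 0 < u \<Longrightarrow> g u \<le> b" "\<And>u. x \<le> u \<Longrightarrow> 0 < u \<Longrightarrow> g u = 0" and b: "0 \<le> b"
  shows "(\<integral>\<^sup>+u. ennreal (g u) \<partial>pos_lborel) \<le> ennreal (b * \<bar>x\<bar>)"
proof -
  have "(\<integral>\<^sup>+u. ennreal (g u) \<partial>pos_lborel) = (\<integral>\<^sup>+u. ennreal (g u) * indicator {0<..} u \<partial>lborel)"
    by (simp add: nn_integral_restrict_space)
  also have "\<dots> \<le> (\<integral>\<^sup>+u. ennreal b * indicator {0..\<bar>x\<bar>} u \<partial>lborel)"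
  proof (rule nn_integral_mono)
    fix u :: real
    show "ennreal (g u) * indicator {0<..} u \<le> ennreal b * indicator {0..\<bar>x\<bar>} u"
      using assms(1)[of u] assms(2)[of u] by (cases "0 < u \<and> u < x") (auto simp: indicator_def ennreal_leI)
  qed
  also have "\<dots> = ennreal (b * \<bar>x\<bar>)"
    using b by (simp add: nn_integral_cmult_indicator ennreal_mult')
  finally show ?thesis .
qed

text \<open>Height \<open>x^2\<close> times length \<open>\<bar>x\<bar>\<close>: this is the source
  of the third moment.\<close>

lemma nn_integral_excess_sq_le: "(\<integral>\<^sup>+u. ennreal ((excess x u)\<^sup>2) \<partial>pos_lborel) \<le> ennreal (\<bar>x\<bar> ^ 3)"
proof -
  have "(excess x u)\<^sup>2 \<le> x\<^sup>2" if "0 < u" for u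
    unfolding excess_def abs_le_square_iff[symmetric] using that by auto
  then show ?thesis
    using nn_integral_pos_lborel_le[of "\<lambda>u. (excess x u)\<^sup>2" "x\<^sup>2" x]
    by (simp add: excess_def power3_eq_cube power2_eq_square)
qed

lemma nn_integral_exceeds_sq_le: "(\<integral>\<^sup>+u. ennreal ((exceeds x u)\<^sup>2) \<partial>pos_lborel) \<le> ennreal \<bar>x\<bar>"
  using nn_integral_pos_lborel_le[of "\<lambda>u. (exceeds x u)\<^sup>2" 1 x] by (simp add: exceeds_def)

section \<open>The statistic and its limit in terms of the kernels\<close>

text \<open>The event \<open>u / s < x / s\<close> is the same for all \<open>s > 0\<close>, so the
  scaling survives only as a factor \<open>1 / s\<close> on \<open>excess\<close>. The case
  \<open>s = 1\<close> describes the integrand of \<open>z_fun\<close>.\<close>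

lemma residual_summand:
  assumes "0 < s"
  shows "(x / s - 1 / s * u - 1) * indicator {1 / s * u<..} (x / s) = 1 / s * excess x u - exceeds x u"
  using assms by (auto simp: excess_def exceeds_def indicator_def field_simps)

lemma T_stat_rescaled:
  assumes n: "n \<ge> 1" and s: "0 < s" "s = sample_mean X n \<omega>"
  shows "T_stat X n a \<omega> / real n = 1 / s * (LINT u|pos_lborel.
      (1 / s * (1 / real n * (\<Sum>j=1..n. excess (X j \<omega>) u)) - 1 / real n * (\<Sum>j=1..n. exceeds (X j \<omega>) u))\<^sup>2
        * exp (- a * u / s))"
proof -
  have "1 / real n * (\<Sum>j=1..n. (scaled X n j \<omega> - 1 / s * u - 1) * indicator {1 / s * u<..} (scaled X n j \<omega>))
      = 1 / s * (1 / real n * (\<Sum>j=1..n. excess (X j \<omega>) u)) - 1 / real n * (\<Sum>j=1..n. exceeds (X j \<omega>) u)" for u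
    unfolding scaled_def s(2)[symmetric] residual_summand[OF s(1)]
    by (simp add: sum_subtractf sum_divide_distrib[symmetric] diff_divide_distrib)
  \<comment> \<open>The half-line is invariant under positive scaling, so the substitution
    \<open>y = u / s\<close> contributes only its Jacobian \<open>1 / s\<close>.\<close>
  moreover have "indicator {0<..} (1 / s * u) = (indicator {0<..} u :: real)" for u
    using s(1) by (auto simp: indicator_def zero_less_divide_iff)
  ultimately show ?thesis
    unfolding T_stat_def integral_pos_lborel set_lebesgue_integral_def using n s(1)
    by (subst lborel_integral_real_affine[of "1 / s" _ 0]) simp_all
qed

lemma T_stat_measurable:
  assumes "\<And>i. i \<ge> 1 \<Longrightarrow> X i \<in> borel_measurable M"
  shows "T_stat X n a \<in> borel_measurable M"
proof -
  have [measurable]: "sample_mean X n \<in> borel_measurable M"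
    unfolding sample_mean_def using assms by (intro borel_measurable_times borel_measurable_sum) auto
  have sc: "scaled X n j \<in> borel_measurable M" if "j \<ge> 1" for j
    unfolding scaled_def using assms[OF that] by measurable
  \<comment> \<open>Joint measurability in the outcome and in \<open>y\<close> makes the integral
    over \<open>y\<close> measurable in the outcome.\<close>
  have [measurable]: "(\<lambda>p. \<Sum>j=1..n. (scaled X n j (fst p) - snd p - 1) * indicator {snd p<..} (scaled X n j (fst p)))
      \<in> borel_measurable (M \<Otimes>\<^sub>M lborel)"
  proof (rule borel_measurable_sum)
    fix j assume "j \<in> {1..n}"
    then have [measurable]: "scaled X n j \<in> borel_measurable M" by (intro sc) auto
    show "(\<lambda>p. (scaled X n j (fst p) - snd p - 1) * indicator {snd p<..} (scaled X n j (fst p)))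
        \<in> borel_measurable (M \<Otimes>\<^sub>M lborel)"
      unfolding indicator_def greaterThan_iff by measurable
  qed
  show ?thesis
    unfolding T_stat_def set_lebesgue_integral_def by measurable
qed

lemma (in prob_space) Delta_eq:
  assumes V: "integrable M V"
  shows "Delta M V a = (LINT u|pos_lborel.
      (expectation (\<lambda>\<omega>. excess (V \<omega>) u) - expectation (\<lambda>\<omega>. exceeds (V \<omega>) u))\<^sup>2 * exp (- a * u))"
proof -
  have [measurable]: "V \<in> borel_measurable M" using V by simp
  have "integrable M (\<lambda>\<omega>. excess (V \<omega>) u)" for u
    unfolding excess_def using V by (intro integrable_max) auto
  moreover have "integrable M (\<lambda>\<omega>. exceeds (V \<omega>) u)" for u
    unfolding exceeds_def by (rule integrable_const_bound[of _ 1]) auto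
  ultimately have "z_fun M V u = expectation (\<lambda>\<omega>. excess (V \<omega>) u) - expectation (\<lambda>\<omega>. exceeds (V \<omega>) u)" for u
    using residual_summand[of 1 _ u] by (simp add: z_fun_def)
  then show ?thesis
    by (simp add: Delta_def integral_pos_lborel)
qed

section \<open>Markov's inequality and convergence in probability\<close>

lemma (in prob_space) prob_ge_tendsto_0:
  fixes W :: "nat \<Rightarrow> 'a \<Rightarrow> ennreal"
  assumes meas: "\<And>n. n \<ge> 1 \<Longrightarrow> W n \<in> borel_measurable M"
    and bound: "\<And>n. n \<ge> 1 \<Longrightarrow> (\<integral>\<^sup>+\<omega>. W n \<omega> \<partial>M) \<le> ennreal (C / real n)"
    and C: "0 \<le> C" and c: "0 < c"
  shows "(\<lambda>n. prob {\<omega> \<in> space M. ennreal c \<le> W n \<omega>}) \<longlonglongrightarrow> 0"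
proof (rule Lim_null_comparison)
  show "\<forall>\<^sub>F n in sequentially. norm (prob {\<omega> \<in> space M. ennreal c \<le> W n \<omega>}) \<le> C / c * (1 / real n)"
  \<comment> \<open>Index 0 is left out because \<open>C / real 0\<close> is 0 by
    convention.\<close>
  proof (rule eventually_sequentiallyI[of 1])
    fix n :: nat assume n: "1 \<le> n"
    have [measurable]: "W n \<in> borel_measurable M" by (rule meas[OF n])
    have le1: "1 \<le> ennreal (1 / c) * w" if "ennreal c \<le> w" for w
      using mult_left_mono[OF that, of "ennreal (1 / c)"] c by (simp flip: ennreal_mult')
    have "emeasure M {\<omega> \<in> space M. ennreal c \<le> W n \<omega>}
        \<le> emeasure M ({\<omega> \<in> space M. 1 \<le> ennreal (1 / c) * W n \<omega>} \<inter> space M)"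
      using le1 by (intro emeasure_mono) auto
    also have "\<dots> \<le> ennreal (1 / c) * (\<integral>\<^sup>+\<omega>. W n \<omega> * indicator (space M) \<omega> \<partial>M)"
      using nn_integral_Markov_inequality[where u = "W n" and M = M and A = "space M" and c = "ennreal (1 / c)"]
      by (simp add: Int_def conj_commute)
    also have "(\<integral>\<^sup>+\<omega>. W n \<omega> * indicator (space M) \<omega> \<partial>M) = (\<integral>\<^sup>+\<omega>. W n \<omega> \<partial>M)"
      by (intro nn_integral_cong) simp
    also have "ennreal (1 / c) * (\<integral>\<^sup>+\<omega>. W n \<omega> \<partial>M) \<le> ennreal (1 / c) * ennreal (C / real n)"
      by (intro mult_left_mono bound n) simp
    also have "\<dots> = ennreal (C / c * (1 / real n))"
      using C c by (simp add: mult.commute flip: ennreal_mult')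
    finally show "norm (prob {\<omega> \<in> space M. ennreal c \<le> W n \<omega>}) \<le> C / c * (1 / real n)"
      using C c by (simp add: emeasure_eq_measure)
  qed
  show "(\<lambda>n. C / c * (1 / real n)) \<longlonglongrightarrow> 0"
    by (intro tendsto_mult_right_zero lim_1_over_n)
qed

theorem theorem3p1:
  fixes M :: "'a measure" and X :: "nat \<Rightarrow> 'a \<Rightarrow> real" and a :: real
  assumes "prob_space M"
    and "prob_space.indep_vars M (\<lambda>_. borel) X {1..}"
    and "\<And>i. i \<ge> 1 \<Longrightarrow> distr M borel (X i) = distr M borel (X 1)"
    and "\<And>i. i \<ge> 1 \<Longrightarrow> AE \<omega> in M. X i \<omega> > 0"
    and "integrable M (X 1)" and "(LINT \<omega>|M. X 1 \<omega>) = 1"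
    and "integrable M (\<lambda>\<omega>. \<bar>X 1 \<omega>\<bar> ^ 3)"
    and "a \<ge> 0"
  shows "converges_in_prob M (\<lambda>n \<omega>. T_stat X n a \<omega> / real n) (\<lambda>_. Delta M (X 1) a)"
proof -
  interpret prob_space M by fact
  interpret N: sigma_finite_measure pos_lborel by (rule sigma_finite_pos_lborel)
  note indep = assms(2) and ident = assms(3)
  have rv: "X i \<in> borel_measurable M" if "i \<ge> 1" for i
    using indep that by (auto simp: indep_vars_def)
  have rv1[measurable]: "X 1 \<in> borel_measurable M" by (rule rv) simp
  note [measurable] = excess_measurable exceeds_measurable
  \<comment> \<open>This constant dominates all three second moments:
    \<open>\<bar>x\<bar> ^ 3\<close> for \<open>excess\<close>, \<open>\<bar>x\<bar>\<close> for
    \<open>exceeds\<close>, and \<open>x^2\<close> for the sample mean.\<close>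
  define C where "C = expectation (\<lambda>\<omega>. \<bar>X 1 \<omega>\<bar> + \<bar>X 1 \<omega>\<bar> ^ 3)"
  have C0: "0 \<le> C" unfolding C_def by (intro integral_nonneg_AE) auto
  have moment: "(\<integral>\<^sup>+\<omega>. g (X 1 \<omega>) \<partial>M) \<le> ennreal C" if "\<And>x. g x \<le> ennreal (\<bar>x\<bar> + \<bar>x\<bar> ^ 3)" for g
  proof -
    have "(\<integral>\<^sup>+\<omega>. g (X 1 \<omega>) \<partial>M) \<le> (\<integral>\<^sup>+\<omega>. ennreal (\<bar>X 1 \<omega>\<bar> + \<bar>X 1 \<omega>\<bar> ^ 3) \<partial>M)"
      by (intro nn_integral_mono that)
    also have "\<dots> = ennreal C"
      unfolding C_def using assms(5,7) by (intro nn_integral_eq_integral) auto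
    finally show ?thesis .
  qed
  have square_le: "x\<^sup>2 \<le> \<bar>x\<bar> + \<bar>x\<bar> ^ 3" for x :: real
  proof -
    have "0 \<le> \<bar>x\<bar> * (\<bar>x\<bar> - 1)\<^sup>2" by simp
    also have "\<dots> = \<bar>x\<bar> + \<bar>x\<bar> ^ 3 - 2 * x\<^sup>2"
      by (simp add: power2_eq_square power3_eq_cube algebra_simps)
    finally show ?thesis using zero_le_power2[of x] by linarith
  qed
  have m_excess: "(\<integral>\<^sup>+\<omega>. \<integral>\<^sup>+u. ennreal ((excess (X 1 \<omega>) u)\<^sup>2) \<partial>pos_lborel \<partial>M) \<le> ennreal C"
    by (rule moment) (auto intro: order_trans[OF nn_integral_excess_sq_le] ennreal_leI)
  have m_exceeds: "(\<integral>\<^sup>+\<omega>. \<integral>\<^sup>+u. ennreal ((exceeds (X 1 \<omega>) u)\<^sup>2) \<partial>pos_lborel \<partial>M) \<le> ennreal C"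
    by (rule moment) (auto intro: order_trans[OF nn_integral_exceeds_sq_le] ennreal_leI)
  have m_square: "(\<integral>\<^sup>+\<omega>. ennreal ((X 1 \<omega>)\<^sup>2) \<partial>M) \<le> ennreal C"
    by (rule moment) (intro ennreal_leI square_le)
  define A where "A u = expectation (\<lambda>\<omega>. excess (X 1 \<omega>) u)" for u
  define B where "B u = expectation (\<lambda>\<omega>. exceeds (X 1 \<omega>) u)" for u
  define A' where "A' n \<omega> u = 1 / real n * (\<Sum>j=1..n. excess (X j \<omega>) u)" for n \<omega> u
  define B' where "B' n \<omega> u = 1 / real n * (\<Sum>j=1..n. exceeds (X j \<omega>) u)" for n \<omega> u
  have AB[measurable]: "A \<in> borel_measurable pos_lborel" "B \<in> borel_measurable pos_lborel"
    unfolding A_def B_def by measurable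
  have A'B'[measurable]: "case_prod (A' n) \<in> borel_measurable (M \<Otimes>\<^sub>M pos_lborel)"
      "case_prod (B' n) \<in> borel_measurable (M \<Otimes>\<^sub>M pos_lborel)" for n
  proof -
    \<comment> \<open>Measurability of \<open>X j\<close> is available for \<open>j \<ge> 1\<close>,
      so the summands are handled inside the index range.\<close>
    have "(\<lambda>p. excess (X j (fst p)) (snd p)) \<in> borel_measurable (M \<Otimes>\<^sub>M pos_lborel)"
      "(\<lambda>p. exceeds (X j (fst p)) (snd p)) \<in> borel_measurable (M \<Otimes>\<^sub>M pos_lborel)"
      if "j \<in> {1..n}" for j
    proof -
      have [measurable]: "X j \<in> borel_measurable M" using that by (intro rv) auto
      show "(\<lambda>p. excess (X j (fst p)) (snd p)) \<in> borel_measurable (M \<Otimes>\<^sub>M pos_lborel)"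
        "(\<lambda>p. exceeds (X j (fst p)) (snd p)) \<in> borel_measurable (M \<Otimes>\<^sub>M pos_lborel)"
        by measurable
    qed
    then show "case_prod (A' n) \<in> borel_measurable (M \<Otimes>\<^sub>M pos_lborel)"
      "case_prod (B' n) \<in> borel_measurable (M \<Otimes>\<^sub>M pos_lborel)"
      unfolding A'_def B'_def split_beta'
      by (intro borel_measurable_times borel_measurable_const borel_measurable_sum; blast)+
  qed
  have S[measurable]: "sample_mean X n \<in> borel_measurable M" for n
    unfolding sample_mean_def using rv by (intro borel_measurable_times borel_measurable_sum) auto
  define W1 where "W1 n \<omega> = ennreal ((sample_mean X n \<omega> - 1)\<^sup>2)" for n \<omega>
  define W2 where "W2 n \<omega> = (\<integral>\<^sup>+u. ennreal ((A' n \<omega> u - A u)\<^sup>2) \<partial>pos_lborel)" for n \<omega>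
  define W3 where "W3 n \<omega> = (\<integral>\<^sup>+u. ennreal ((B' n \<omega> u - B u)\<^sup>2) \<partial>pos_lborel)" for n \<omega>
  \<comment> \<open>Adding the three deviations lets one application of Markov's inequality control
    them simultaneously.\<close>
  define W where "W n \<omega> = W1 n \<omega> + W2 n \<omega> + W3 n \<omega>" for n \<omega>
  have Wm[measurable]: "W1 n \<in> borel_measurable M" "W2 n \<in> borel_measurable M" "W3 n \<in> borel_measurable M" for n
    unfolding W1_def W2_def W3_def by measurable
  have Wmeas: "W n \<in> borel_measurable M" for n
    unfolding W_def by measurable
  have Wbound: "(\<integral>\<^sup>+\<omega>. W n \<omega> \<partial>M) \<le> ennreal (3 * C / real n)" if n: "n \<ge> 1" for n
  proof -
    have scale: "w \<le> ennreal (C / real n)" if "w \<le> ennreal (1 / real n) * v" "v \<le> ennreal C" for v w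
    proof -
      have "w \<le> ennreal (1 / real n) * ennreal C"
        using that by (meson mult_left_mono order_trans zero_le)
      then show ?thesis using C0 by (simp flip: ennreal_mult')
    qed
    have "(\<integral>\<^sup>+\<omega>. W1 n \<omega> \<partial>M) \<le> ennreal (C / real n)"
      using scale[OF nn_integral_mean_deviation_le[OF indep ident _ n, of "\<lambda>x. x"] m_square]
      unfolding assms(6) W1_def sample_mean_def by simp
    moreover have "(\<integral>\<^sup>+\<omega>. W2 n \<omega> \<partial>M) \<le> ennreal (C / real n)"
      unfolding W2_def A'_def A_def
      by (rule scale[OF nn_integral_kernel_mean_deviation_le[OF indep ident sigma_finite_pos_lborel excess_measurable n] m_excess])
    moreover have "(\<integral>\<^sup>+\<omega>. W3 n \<omega> \<partial>M) \<le> ennreal (C / real n)"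
      unfolding W3_def B'_def B_def
      by (rule scale[OF nn_integral_kernel_mean_deviation_le[OF indep ident sigma_finite_pos_lborel exceeds_measurable n] m_exceeds])
    ultimately have "(\<integral>\<^sup>+\<omega>. W n \<omega> \<partial>M) \<le> ennreal (C / real n) + ennreal (C / real n) + ennreal (C / real n)"
      unfolding W_def by (simp add: nn_integral_add add_mono)
    also have "\<dots> = ennreal (3 * C / real n)"
      using C0 by (simp flip: ennreal_plus)
    finally show ?thesis .
  qed
  have A2: "integrable pos_lborel (\<lambda>u. (A u)\<^sup>2)" and B2: "integrable pos_lborel (\<lambda>u. (B u)\<^sup>2)"
    unfolding A_def B_def using m_excess m_exceeds
    by (auto intro!: integrable_kernel_mean_square sigma_finite_pos_lborel excess_measurable
        exceeds_measurable rv intro: le_less_trans)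
  show ?thesis
    unfolding converges_in_prob_def
  proof (intro conjI allI impI)
    show "(\<lambda>\<omega>. T_stat X n a \<omega> / real n) \<in> borel_measurable M" for n
      using T_stat_measurable[of X M n a] rv by auto
    show "(\<lambda>_. Delta M (X 1) a) \<in> borel_measurable M" by simp
    fix e :: real assume e: "0 < e"
    obtain c where c: "0 < c" and stable: "\<And>A' B' s. A' \<in> borel_measurable pos_lborel \<Longrightarrow>
        B' \<in> borel_measurable pos_lborel \<Longrightarrow> (s - 1)\<^sup>2 < c \<Longrightarrow>
        (\<integral>\<^sup>+u. ennreal ((A' u - A u)\<^sup>2) \<partial>pos_lborel) < ennreal c \<Longrightarrow>
        (\<integral>\<^sup>+u. ennreal ((B' u - B u)\<^sup>2) \<partial>pos_lborel) < ennreal c \<Longrightarrow>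
        0 < s \<and> \<bar>1 / s * (LINT u|pos_lborel. (1 / s * A' u - B' u)\<^sup>2 * exp (- a * u / s))
          - (LINT u|pos_lborel. (A u - B u)\<^sup>2 * exp (- a * u))\<bar> < e"
      by (rule scaled_energy_stable[OF AB ident_measurable_pos_lborel _ assms(8) e A2 B2])
         (auto simp: space_restrict_space)
    have close: "\<bar>T_stat X n a \<omega> / real n - Delta M (X 1) a\<bar> < e"
      if n: "n \<ge> 1" and \<omega>: "\<omega> \<in> space M" and W: "W n \<omega> < ennreal c" for n \<omega>
    proof -
      have "W1 n \<omega> \<le> W n \<omega>" "W2 n \<omega> \<le> W n \<omega>" "W3 n \<omega> \<le> W n \<omega>"
        unfolding W_def by (auto intro: add_increasing add_increasing2)
      then have less: "W1 n \<omega> < ennreal c" "W2 n \<omega> < ennreal c" "W3 n \<omega> < ennreal c"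
        using W by auto
      have 1: "(sample_mean X n \<omega> - 1)\<^sup>2 < c"
        using less(1) by (simp add: W1_def ennreal_less_iff)
      have "A' n \<omega> \<in> borel_measurable pos_lborel" "B' n \<omega> \<in> borel_measurable pos_lborel"
        using measurable_Pair2[OF A'B'(1) \<omega>] measurable_Pair2[OF A'B'(2) \<omega>] by simp_all
      note st = stable[OF this 1 less(2)[unfolded W2_def] less(3)[unfolded W3_def]]
      \<comment> \<open>Positivity of the sample mean at this outcome, required by the substitution,
        is the first half of \<open>st\<close>.\<close>
      have "T_stat X n a \<omega> / real n = 1 / sample_mean X n \<omega> * (LINT u|pos_lborel.
          (1 / sample_mean X n \<omega> * A' n \<omega> u - B' n \<omega> u)\<^sup>2 * exp (- a * u / sample_mean X n \<omega>))"
        unfolding A'_def B'_def by (rule T_stat_rescaled[OF n _ refl]) (use st in simp)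
      moreover have "Delta M (X 1) a = (LINT u|pos_lborel. (A u - B u)\<^sup>2 * exp (- a * u))"
        unfolding A_def B_def by (rule Delta_eq[OF assms(5)])
      ultimately show ?thesis using st by simp
    qed
    show "(\<lambda>n. prob {\<omega> \<in> space M. \<bar>T_stat X n a \<omega> / real n - Delta M (X 1) a\<bar> > e}) \<longlonglongrightarrow> 0"
    proof (rule Lim_null_comparison[OF _ prob_ge_tendsto_0[OF Wmeas Wbound _ c]])
      show "\<forall>\<^sub>F n in sequentially. norm (prob {\<omega> \<in> space M. \<bar>T_stat X n a \<omega> / real n - Delta M (X 1) a\<bar> > e})
          \<le> prob {\<omega> \<in> space M. ennreal c \<le> W n \<omega>}"
      proof (rule eventually_sequentiallyI[of 1])
        fix n :: nat assume n: "1 \<le> n"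
        have [measurable]: "W n \<in> borel_measurable M" by (rule Wmeas)
        \<comment> \<open>Contrapositive of \<open>close\<close>: an outcome with error above
          \<open>e\<close> must have \<open>W\<close> at least \<open>c\<close>.\<close>
        have "{\<omega> \<in> space M. \<bar>T_stat X n a \<omega> / real n - Delta M (X 1) a\<bar> > e}
            \<subseteq> {\<omega> \<in> space M. ennreal c \<le> W n \<omega>}"
          using close[OF n] by (force simp: not_less[symmetric])
        then show "norm (prob {\<omega> \<in> space M. \<bar>T_stat X n a \<omega> / real n - Delta M (X 1) a\<bar> > e})
            \<le> prob {\<omega> \<in> space M. ennreal c \<le> W n \<omega>}"
          by (simp add: finite_measure_mono)
      qed
    qed (use C0 in auto)
  qed
qed

end
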